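(* Let $u$ be a set, let $V:u\to\mathbb{N}$, and for $n\in\mathbb{N}$ put $v(n)=\{z\in u\mid V(z)=n\}$ and $v'(n)=\{z\in u\mid V(z)<n\}$. Let $f:\mathcal{P}(u)\to\mathcal{P}(u)$ be a conjunctive set transformer and let $p\subseteq u$ be such that $v(n)\cap p\subseteq f(v'(n))$ for every $n\in\mathbb{N}$ and $p\subseteq f(p)$. Then $p\subseteq\mathrm{fix}(f)$, where $\mathrm{fix}(f)$ is the least fixpoint of $f$.
   Context: A set transformer $f$ on $u$ is conjunctive if it distributes over (nonempty) intersections, e.g. $f(x\cap y)=f(x)\cap f(y)$; in particular it is monotonic, so its least fixpoint exists. *)

theory Defs
  imports Main "HOL-Library.FuncSet"
begin

text \<open>
  A set transformer on \<open>u\<close> is a map \<open>f \<in> Pow u \<rightarrow> Pow u\<close>; its values outside \<open>Pow u\<close> are irrelevant,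
  so every notion below only looks at subsets of \<open>u\<close>.  The empty family is excluded, i.e.
  \<open>f u = u\<close> is not required.
\<close>

definition conjunctive_on :: "'a set \<Rightarrow> ('a set \<Rightarrow> 'a set) \<Rightarrow> bool" where
  "conjunctive_on u f \<longleftrightarrow>
     (\<forall>X. X \<subseteq> Pow u \<and> X \<noteq> {} \<longrightarrow> f (\<Inter>X) = (\<Inter>x\<in>X. f x))"

text \<open>
  The library's \<open>lfp\<close> is not applicable, since it also looks at the values of \<open>f\<close> on sets that
  are not contained in \<open>u\<close>.
\<close>

definition lfp_on :: "'a set \<Rightarrow> ('a set \<Rightarrow> 'a set) \<Rightarrow> 'a set" where
  "lfp_on u f = (LEAST x. x \<subseteq> u \<and> f x = x)"

lemma conjunctive_on_Int:
  assumes "conjunctive_on u f" "x \<subseteq> u" "y \<subseteq> u"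
  shows "f (x \<inter> y) = f x \<inter> f y"
proof -
  have sub: "{x, y} \<subseteq> Pow u"
    using assms(2,3) by simp
  have "f (\<Inter>{x, y}) = (\<Inter>z\<in>{x, y}. f z)"
    by (rule assms(1)[unfolded conjunctive_on_def, rule_format]) (use sub in simp)
  then show ?thesis by simp
qed

lemma conjunctive_on_mono:
  assumes "conjunctive_on u f" "x \<subseteq> y" "y \<subseteq> u"
  shows "f x \<subseteq> f y"
proof -
  have "f (x \<inter> y) = f x \<inter> f y"
    by (rule conjunctive_on_Int[OF assms(1) subset_trans[OF assms(2,3)] assms(3)])
  then have "f x = f x \<inter> f y"
    by (simp only: Int_absorb2[OF assms(2)])
  then show ?thesis by (simp only: inf.order_iff)
qed

text \<open>For conjunctive \<open>f\<close> the description in \<open>lfp_on\<close> is proper: the least fixpoint exists.\<close>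

lemma
  assumes f: "f \<in> Pow u \<rightarrow> Pow u" and conj: "conjunctive_on u f"
  shows lfp_on_subset: "lfp_on u f \<subseteq> u"
    and lfp_on_fixpoint: "f (lfp_on u f) = lfp_on u f"
    and lfp_on_least: "\<And>y. y \<subseteq> u \<Longrightarrow> f y = y \<Longrightarrow> lfp_on u f \<subseteq> y"
proof -
  define m where "m = \<Inter>{x. x \<subseteq> u \<and> f x \<subseteq> x}"
  have fu: "f x \<subseteq> u" if "x \<subseteq> u" for x
    using funcset_mem[OF f, of x] that by simp
  have m_lower: "m \<subseteq> x" if "x \<subseteq> u" "f x \<subseteq> x" for x
    unfolding m_def by (rule Inter_lower) (simp add: that)
  have mu: "m \<subseteq> u" by (rule m_lower[OF subset_refl fu[OF subset_refl]])
  have le: "f m \<subseteq> m"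
  proof (subst (2) m_def, rule Inter_greatest)
    fix x assume "x \<in> {x. x \<subseteq> u \<and> f x \<subseteq> x}"
    then have x: "x \<subseteq> u" "f x \<subseteq> x" by simp_all
    show "f m \<subseteq> x"
      by (rule subset_trans[OF conjunctive_on_mono[OF conj m_lower[OF x] x(1)] x(2)])
  qed
  have "m \<subseteq> f m"
    by (rule m_lower[OF fu[OF mu] conjunctive_on_mono[OF conj le mu]])
  with le have fm: "f m = m" by (rule subset_antisym)
  have least: "m \<subseteq> y" if "y \<subseteq> u" "f y = y" for y
    by (rule m_lower) (simp_all add: that)
  have eq: "lfp_on u f = m"
    unfolding lfp_on_def by (rule Least_equality) (simp_all add: mu fm least)
  show "lfp_on u f \<subseteq> u" "f (lfp_on u f) = lfp_on u f"
    by (simp_all add: eq mu fm)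
  show "lfp_on u f \<subseteq> y" if "y \<subseteq> u" "f y = y" for y
    unfolding eq by (rule least[OF that])
qed

end

theory Submission
  imports Defs
begin

text \<open>
  Conjunctivity turns the two hypotheses on \<open>p\<close> into \<open>v n \<inter> p \<subseteq> f (v' n) \<inter> f p = f (v' n \<inter> p)\<close>, so
  well-founded induction on the variant \<open>V\<close> applies: if \<open>v' n \<inter> p\<close> lies in the least fixpoint, then
  so does \<open>f (v' n \<inter> p)\<close> by monotonicity.
\<close>

theorem theorem3:
  fixes u p :: "'a set" and V :: "'a \<Rightarrow> nat" and f :: "'a set \<Rightarrow> 'a set"
    and v v' :: "nat \<Rightarrow> 'a set"
  assumes v_def: "\<And>n. v n = {z \<in> u. V z = n}"
    and v'_def: "\<And>n. v' n = {z \<in> u. V z < n}"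
    and "f \<in> Pow u \<rightarrow> Pow u"
    and "conjunctive_on u f"
    and "p \<subseteq> u"
    and "\<And>n. v n \<inter> p \<subseteq> f (v' n)"
    and "p \<subseteq> f p"
  shows "p \<subseteq> lfp_on u f"
proof
  let ?L = "lfp_on u f"
  fix z assume "z \<in> p"
  then show "z \<in> ?L"
  proof (induction "V z" arbitrary: z rule: less_induct)
    case less
    let ?n = "V z"
    have v'u: "v' ?n \<subseteq> u"
      by (auto simp: v'_def)
    have "z \<in> v ?n \<inter> p"
      using less.prems \<open>p \<subseteq> u\<close> by (auto simp: v_def)
    then have "z \<in> f (v' ?n) \<inter> f p"
      using assms(6) \<open>p \<subseteq> f p\<close> by blast
    \<comment> \<open>The intersection with \<open>p\<close> has to move inside \<open>f\<close>,
      because the induction hypothesis speaks only of points of \<open>p\<close>, not of all of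
      \<open>v' ?n\<close>.\<close>
    also have "\<dots> = f (v' ?n \<inter> p)"
      by (rule conjunctive_on_Int[OF assms(4) v'u assms(5), symmetric])
    also have "\<dots> \<subseteq> f ?L"
    proof (rule conjunctive_on_mono[OF assms(4) _ lfp_on_subset[OF assms(3,4)]])
      \<comment> \<open>Points of this set lie in \<open>p\<close> and have variant below
        \<open>?n\<close>, so the induction hypothesis covers them. For \<open>?n = 0\<close> the
        set is empty, which takes the place of a base case.\<close>
      show "v' ?n \<inter> p \<subseteq> ?L"
        using less.hyps by (auto simp: v'_def)
    qed
    also have "\<dots> = ?L"
      by (rule lfp_on_fixpoint[OF assms(3,4)])
    finally show ?case .
  qed
qed

end
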